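(* Let $L$ be a decomposable lattice and let $I\neq\{0\}$ be an ideal of $L$. The following conditions are equivalent: (1) $I$ is totally ordered. (2) For every $0<a\in I$, $a^{\perp}=I^{\perp}$. (3) $I^{\perp}$ is a prime ideal of $L$. (4) $I^{\perp}$ is a minimal prime ideal of $L$. (5) $I^{\perp\perp}$ is a maximal totally ordered ideal of $L$. (6) $I^{\perp\perp}$ is a minimal polar ideal of $L$. (7) $I^{\perp}$ is a maximal polar ideal of $L$. (8) Every $0<a\in I$ is special.
   Context: A decomposable lattice is a distributive lattice $L$ with minimum element $0$ such that for any $a,b\in L$ that are not comparable there exist $\overline{a},\overline{b}\in L$ with $a=\overline{a}\vee(a\wedge b)$, $b=\overline{b}\vee(a\wedge b)$ and $\overline{a}\wedge\overline{b}=0$. An ideal of $L$ is a nonempty subset closed under $\vee$ and downward closed. An ideal $P$ is prime if $P\neq L$ and $a\wedge b\in P$ implies $a\in P$ or $b\in P$; a minimal prime ideal is a prime ideal minimal under inclusion among prime ideals. For $\emptyset\neq A\subseteq L$, $A^{\perp}=\{x\in L\mid x\wedge a=0\text{ for all }a\in A\}$, $A^{\perp\perp}=(A^{\perp})^{\perp}$, and $a^{\perp}=\{a\}^{\perp}$. An ideal is polar if it equals $A^{\perp}$ for some $\emptyset\neq A\subseteq L$. A minimal polar ideal is one minimal (under inclusion) among the nonzero polar ideals; a maximal polar ideal is one maximal among the polar ideals different from $L$. A maximal totally ordered ideal is an ideal maximal under inclusion among the ideals that are totally ordered. For $0<a\in L$, a value of $a$ is an ideal maximal among the ideals not containing $a$;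 $a$ is special if it has exactly one value. *)

theory Defs
  imports Main
begin

class decomposable_lattice = distrib_lattice + order_bot +
  assumes decomposable:
    "\<not> a \<le> b \<Longrightarrow> \<not> b \<le> a \<Longrightarrow>
      \<exists>a' b'. a = sup a' (inf a b) \<and> b = sup b' (inf a b) \<and> inf a' b' = bot"

definition lattice_ideal :: "'a::lattice set \<Rightarrow> bool" where
  "lattice_ideal I \<longleftrightarrow>
     I \<noteq> {} \<and> (\<forall>x\<in>I. \<forall>y\<in>I. sup x y \<in> I) \<and> (\<forall>x\<in>I. \<forall>y. y \<le> x \<longrightarrow> y \<in> I)"

definition maximal_in :: "'a set set \<Rightarrow> 'a set \<Rightarrow> bool" where
  "maximal_in F M \<longleftrightarrow> M \<in> F \<and> (\<forall>N\<in>F. M \<subseteq> N \<longrightarrow> N = M)"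

definition minimal_in :: "'a set set \<Rightarrow> 'a set \<Rightarrow> bool" where
  "minimal_in F M \<longleftrightarrow> M \<in> F \<and> (\<forall>N\<in>F. N \<subseteq> M \<longrightarrow> N = M)"

definition prime_lattice_ideal :: "'a::lattice set \<Rightarrow> bool" where
  "prime_lattice_ideal P \<longleftrightarrow>
     lattice_ideal P \<and> P \<noteq> UNIV \<and> (\<forall>a b. inf a b \<in> P \<longrightarrow> a \<in> P \<or> b \<in> P)"

definition minimal_prime_ideal :: "'a::lattice set \<Rightarrow> bool" where
  "minimal_prime_ideal P \<longleftrightarrow> minimal_in {Q. prime_lattice_ideal Q} P"

definition perp :: "'a::{lattice, order_bot} set \<Rightarrow> 'a set" where
  "perp A = {x. \<forall>a\<in>A. inf x a = bot}"

definition polar_ideal :: "'a::{lattice, order_bot} set \<Rightarrow> bool" where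
  "polar_ideal P \<longleftrightarrow> lattice_ideal P \<and> (\<exists>A. A \<noteq> {} \<and> P = perp A)"

definition minimal_polar_ideal :: "'a::{lattice, order_bot} set \<Rightarrow> bool" where
  "minimal_polar_ideal P \<longleftrightarrow> minimal_in {Q. polar_ideal Q \<and> Q \<noteq> {bot}} P"

definition maximal_polar_ideal :: "'a::{lattice, order_bot} set \<Rightarrow> bool" where
  "maximal_polar_ideal P \<longleftrightarrow> maximal_in {Q. polar_ideal Q \<and> Q \<noteq> UNIV} P"

definition maximal_totally_ordered_ideal :: "'a::lattice set \<Rightarrow> bool" where
  "maximal_totally_ordered_ideal J \<longleftrightarrow>
     maximal_in {K. lattice_ideal K \<and> Complete_Partial_Order.chain (\<le>) K} J"

definition value_of :: "'a::lattice \<Rightarrow> 'a set \<Rightarrow> bool" where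
  "value_of a V \<longleftrightarrow> maximal_in {J. lattice_ideal J \<and> a \<notin> J} V"

definition special :: "'a::lattice \<Rightarrow> bool" where
  "special a \<longleftrightarrow> (\<exists>!V. value_of a V)"

end

theory Submission
  imports Defs
begin

text \<open>
  The pivot is the condition that \<^term>\<open>perp {a} = perp I\<close> for all nonzero \<open>a\<close> in \<open>I\<close>.
  It says that \<open>I\<close> contains no two nonzero elements with zero meet: if \<open>x\<close> annihilates \<open>a\<close>
  but not \<open>I\<close>, then some \<^term>\<open>inf x i\<close> with \<open>i\<close> in \<open>I\<close> is a nonzero element of \<open>I\<close>
  disjoint from \<open>a\<close>.

  Decomposability enters through a single observation (\<open>incomparable_imp_disjoint_parts\<close>): below
  two incomparable elements lie two nonzero disjoint ones. So an ideal is a chain as soon as it has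
  no nonzero disjoint elements, and the converse is clear (\<open>chain_ideal_iff_perp_eq\<close>).

  The conditions on prime and polar ideals (\<open>perp_eq_iff_prime\<close>, \<open>perp_eq_iff_maximal_polar\<close>)
  rest on the same passage from \<open>x\<close> to \<^term>\<open>inf x i\<close>, on the Galois connection that
  \<^const>\<open>perp\<close> forms with itself, and on the fact that a nonzero element of \<open>I\<close> never lies in
  \<^term>\<open>perp I\<close>. Since \<open>I\<close> and \<^term>\<open>perp (perp I)\<close> have the same annihilator, one is a
  chain exactly when the other is.

  If \<open>x\<close> and \<open>y\<close> are nonzero and disjoint, the principal ideals of \<open>x\<close> and of \<open>y\<close> both miss
  \<^term>\<open>sup x y\<close> and extend to values of it by Zorn's lemma. No value of \<^term>\<open>sup x y\<close>
  contains both \<open>x\<close> and \<open>y\<close>, so it has two values (\<open>special_imp_chain_ideal\<close>). Conversely, when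
  \<open>a\<close> lies in a chain ideal, \<^term>\<open>a \<le> sup w x\<close> forces \<^term>\<open>a \<le> w\<close> or \<^term>\<open>a \<le> x\<close>,
  and this rules out two distinct values of \<open>a\<close> (\<open>chain_ideal_imp_special\<close>).
\<close>

section \<open>Ideals and annihilators\<close>

lemma inf_bot_left' [simp]: "inf bot x = (bot :: 'a::{lattice,order_bot})"
  by (rule inf_absorb1) simp

lemma inf_bot_right' [simp]: "inf x bot = (bot :: 'a::{lattice,order_bot})"
  by (rule inf_absorb2) simp

lemma lattice_ideal_downward: "lattice_ideal I \<Longrightarrow> x \<in> I \<Longrightarrow> y \<le> x \<Longrightarrow> y \<in> I"
  unfolding lattice_ideal_def by blast

lemma lattice_ideal_sup: "lattice_ideal I \<Longrightarrow> x \<in> I \<Longrightarrow> y \<in> I \<Longrightarrow> sup x y \<in> I"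
  unfolding lattice_ideal_def by blast

lemma lattice_ideal_nonempty: "lattice_ideal I \<Longrightarrow> I \<noteq> {}"
  unfolding lattice_ideal_def by blast

lemma lattice_ideal_bot: "lattice_ideal I \<Longrightarrow> (bot :: 'a::{lattice,order_bot}) \<in> I"
  using lattice_ideal_nonempty lattice_ideal_downward bot_least by (metis ex_in_conv)

lemma lattice_ideal_atMost: "lattice_ideal {..a::'a::lattice}"
  unfolding lattice_ideal_def by (auto intro: order_trans)

lemma nonzero_ideal_element:
  fixes I :: "'a::{lattice,order_bot} set"
  assumes "lattice_ideal I" and "I \<noteq> {bot}"
  obtains a where "a \<in> I" and "bot < a"
proof -
  have "bot \<in> I" using assms(1) by (rule lattice_ideal_bot)
  then obtain a where "a \<in> I" "a \<noteq> bot" using assms(2) by blast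
  then show thesis using that by (simp add: bot.not_eq_extremum)
qed

lemma mem_perp_iff: "x \<in> perp A \<longleftrightarrow> (\<forall>a\<in>A. inf x a = bot)"
  by (simp add: perp_def)

lemma lattice_ideal_perp: "lattice_ideal (perp (A :: 'a::{distrib_lattice,order_bot} set))"
proof -
  have "bot \<in> perp A"
    by (simp add: mem_perp_iff)
  moreover have "sup x y \<in> perp A" if "x \<in> perp A" "y \<in> perp A" for x y
    using that by (simp add: mem_perp_iff inf_sup_distrib2)
  moreover have "y \<in> perp A" if "x \<in> perp A" "y \<le> x" for x y
    using that unfolding mem_perp_iff by (metis bot_unique inf_mono order_refl)
  ultimately show ?thesis
    unfolding lattice_ideal_def by blast
qed

lemma perp_antimono: "A \<subseteq> B \<Longrightarrow> perp B \<subseteq> perp A"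
  unfolding perp_def by blast

lemma subset_perp_perp: "A \<subseteq> perp (perp A)"
proof
  fix x assume "x \<in> A"
  have "inf x y = bot" if "y \<in> perp A" for y
    using that \<open>x \<in> A\<close> by (simp add: mem_perp_iff inf_commute[of x y])
  then show "x \<in> perp (perp A)" by (simp add: mem_perp_iff[of x])
qed

lemma perp_perp_perp: "perp (perp (perp A)) = perp A"
proof
  show "perp (perp (perp A)) \<subseteq> perp A"
    by (rule perp_antimono) (rule subset_perp_perp)
qed (rule subset_perp_perp)

lemma mem_own_perp: "x \<in> A \<Longrightarrow> x \<in> perp A \<Longrightarrow> x = bot"
  by (drule (1) mem_perp_iff[THEN iffD1, THEN bspec, rotated]) simp

lemma perp_eq_UNIV_iff: "perp A = UNIV \<longleftrightarrow> A \<subseteq> {bot :: 'a::{lattice,order_bot}}"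
proof
  assume "perp A = UNIV"
  then show "A \<subseteq> {bot}" using mem_own_perp[of _ A] by auto
next
  assume "A \<subseteq> {bot}"
  then have "inf x a = bot" if "a \<in> A" for x a using that by auto
  then show "perp A = UNIV" unfolding perp_def by blast
qed

text \<open>Meeting with an element of an ideal moves the failure to annihilate the ideal into the ideal
  itself; this is how a hypothesis on the elements of \<open>I\<close> reaches arbitrary elements.\<close>

lemma not_mem_perp_ideal:
  fixes I :: "'a::{lattice,order_bot} set"
  assumes "lattice_ideal I" and "x \<notin> perp I"
  obtains i where "i \<in> I" and "inf x i \<in> I" and "bot < inf x i"
proof -
  obtain i where i: "i \<in> I" "inf x i \<noteq> bot" using assms(2) unfolding mem_perp_iff by blast
  have "inf x i \<in> I" using assms(1) i(1) inf_le2 by (rule lattice_ideal_downward)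
  then show thesis using that i by (simp add: bot.not_eq_extremum)
qed

lemma polar_ideal_perp: "A \<noteq> {} \<Longrightarrow> polar_ideal (perp (A :: 'a::{distrib_lattice,order_bot} set))"
  unfolding polar_ideal_def using lattice_ideal_perp by blast

lemma polar_ideal_perp_perp: "polar_ideal P \<Longrightarrow> perp (perp P) = P"
  unfolding polar_ideal_def using perp_perp_perp by blast

lemma polar_ideal_perp_polar:
  "polar_ideal (P :: 'a::{distrib_lattice,order_bot} set) \<Longrightarrow> polar_ideal (perp P)"
  using polar_ideal_perp lattice_ideal_bot unfolding polar_ideal_def by blast

lemma perp_UNIV: "perp UNIV = {bot :: 'a::{lattice,order_bot}}"
proof -
  have "bot \<in> perp (UNIV :: 'a set)" by (simp add: mem_perp_iff)
  then show ?thesis using mem_own_perp[of _ "UNIV :: 'a set"] by auto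
qed


section \<open>Chains and constant annihilators\<close>

text \<open>A decomposition writes \<open>a\<close> and \<open>b\<close> as joins of disjoint parts with \<^term>\<open>inf a b\<close>. If one of
  the parts vanished, \<open>a\<close> or \<open>b\<close> would coincide with \<^term>\<open>inf a b\<close> and lie below the other.\<close>

lemma incomparable_imp_disjoint_parts:
  fixes a b :: "'a::decomposable_lattice"
  assumes "\<not> a \<le> b" and "\<not> b \<le> a"
  obtains x y where "x \<le> a" and "y \<le> b" and "bot < x" and "bot < y" and "inf x y = bot"
proof -
  obtain x y where x: "a = sup x (inf a b)" and y: "b = sup y (inf a b)" and xy: "inf x y = bot"
    using decomposable[OF assms] by blast
  have "x \<noteq> bot"
  proof
    assume "x = bot"
    then have "a = inf a b" using x by (metis bot_least sup_absorb2)
    then show False using assms(1) by (metis inf_le2)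
  qed
  moreover have "y \<noteq> bot"
  proof
    assume "y = bot"
    then have "b = inf a b" using y by (metis bot_least sup_absorb2)
    then show False using assms(2) by (metis inf_le1)
  qed
  moreover have "x \<le> a" "y \<le> b" using x y by (metis sup_ge1)+
  ultimately show thesis using that xy by (simp add: bot.not_eq_extremum)
qed

text \<open>In a chain, the smaller of two elements is their meet. For \<open>x\<close> disjoint from \<open>a\<close> and
  any \<open>b\<close> in the chain ideal, \<^term>\<open>inf x b\<close> and \<open>a\<close> have meet zero, so one of them is zero.\<close>

lemma chain_ideal_imp_perp_eq:
  fixes I :: "'a::{lattice,order_bot} set"
  assumes I: "lattice_ideal I" and chain: "Complete_Partial_Order.chain (\<le>) I"
    and a: "a \<in> I" "bot < a"
  shows "perp {a} = perp I"
proof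
  show "perp I \<subseteq> perp {a}" using a by (simp add: perp_antimono)
  show "perp {a} \<subseteq> perp I"
  proof
    fix x assume "x \<in> perp {a}"
    then have disj: "inf x a = bot" by (simp add: mem_perp_iff)
    have "inf x b = bot" if "b \<in> I" for b
    proof -
      have "inf x b \<in> I" using I that inf_le2 by (rule lattice_ideal_downward)
      with chain have "inf x b \<le> a \<or> a \<le> inf x b" using a(1) by (rule chainD)
      then show ?thesis
      proof
        assume "inf x b \<le> a"
        then have "inf x b \<le> inf x a" by simp
        then show ?thesis using disj bot_unique by metis
      next
        assume "a \<le> inf x b"
        then have "a \<le> inf x a" by simp
        then have "a = bot" using disj bot_unique by metis
        then show ?thesis using a(2) by simp
      qed
    qed
    then show "x \<in> perp I" by (simp add: mem_perp_iff)
  qed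
qed

lemma chain_ideal_iff_perp_eq:
  fixes I :: "'a::decomposable_lattice set"
  assumes I: "lattice_ideal I"
  shows "Complete_Partial_Order.chain (\<le>) I \<longleftrightarrow> (\<forall>a\<in>I. bot < a \<longrightarrow> perp {a} = perp I)"
proof
  assume "Complete_Partial_Order.chain (\<le>) I"
  then show "\<forall>a\<in>I. bot < a \<longrightarrow> perp {a} = perp I"
    using chain_ideal_imp_perp_eq[OF I] by blast
next
  assume const: "\<forall>a\<in>I. bot < a \<longrightarrow> perp {a} = perp I"
  show "Complete_Partial_Order.chain (\<le>) I"
  proof (rule chainI, rule ccontr)
    fix a b assume ab: "a \<in> I" "b \<in> I" "\<not> (a \<le> b \<or> b \<le> a)"
    then obtain x y where xy: "x \<le> a" "y \<le> b" "bot < x" "bot < y" "inf x y = bot"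
      using incomparable_imp_disjoint_parts by blast
    have "x \<in> I" "y \<in> I" using ab xy lattice_ideal_downward[OF I] by blast+
    have "y \<in> perp {x}" using xy by (simp add: mem_perp_iff inf_commute)
    then have "y \<in> perp I" using const xy \<open>x \<in> I\<close> by blast
    then show False using mem_own_perp \<open>y \<in> I\<close> xy(4) by blast
  qed
qed


section \<open>Prime annihilators\<close>

text \<open>If \<open>a\<close> does not annihilate \<open>I\<close>, there is a nonzero \<^term>\<open>inf a i\<close> in \<open>I\<close>. When
  \<^term>\<open>inf a b\<close> annihilates \<open>I\<close>, this element is disjoint from \<open>b\<close>, so \<open>b\<close> annihilates all
  of \<open>I\<close>. In the other direction, \<^term>\<open>inf x a = bot\<close> lies in the prime ideal
  \<^term>\<open>perp I\<close> and \<open>a\<close> does not.\<close>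

lemma perp_eq_iff_prime:
  fixes I :: "'a::{distrib_lattice,order_bot} set"
  assumes I: "lattice_ideal I" "I \<noteq> {bot}"
  shows "(\<forall>a\<in>I. bot < a \<longrightarrow> perp {a} = perp I) \<longleftrightarrow> prime_lattice_ideal (perp I)"
proof
  assume const: "\<forall>a\<in>I. bot < a \<longrightarrow> perp {a} = perp I"
  have "b \<in> perp I" if ab: "inf a b \<in> perp I" and a: "a \<notin> perp I" for a b
  proof -
    obtain i where i: "i \<in> I" "inf a i \<in> I" "bot < inf a i"
      using not_mem_perp_ideal[OF I(1) a] by blast
    have "inf b (inf a i) = bot"
      using ab i(1) unfolding mem_perp_iff by (metis inf_assoc inf_commute)
    then have "b \<in> perp {inf a i}" by (simp add: mem_perp_iff)
    then show ?thesis using const i by blast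
  qed
  moreover have "perp I \<noteq> UNIV"
    using I lattice_ideal_bot[OF I(1)] by (auto simp: perp_eq_UNIV_iff)
  ultimately show "prime_lattice_ideal (perp I)"
    unfolding prime_lattice_ideal_def using lattice_ideal_perp by blast
next
  assume prime: "prime_lattice_ideal (perp I)"
  show "\<forall>a\<in>I. bot < a \<longrightarrow> perp {a} = perp I"
  proof (intro ballI impI)
    fix a assume a: "a \<in> I" "bot < a"
    then have "a \<notin> perp I" using mem_own_perp[of _ I] by blast
    moreover have "inf x a \<in> perp I" if "x \<in> perp {a}" for x
      using that lattice_ideal_bot[OF lattice_ideal_perp] by (simp add: mem_perp_iff)
    ultimately have "perp {a} \<subseteq> perp I"
      using prime unfolding prime_lattice_ideal_def by blast
    moreover have "perp I \<subseteq> perp {a}" using a by (simp add: perp_antimono)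
    ultimately show "perp {a} = perp I" by blast
  qed
qed

text \<open>A prime ideal inside \<^term>\<open>perp I\<close> omits some nonzero \<open>a\<close> in \<open>I\<close>. Every \<open>x\<close> in
  \<^term>\<open>perp I\<close> has \<^term>\<open>inf x a = bot\<close>, so primeness puts \<open>x\<close> into the smaller ideal.\<close>

lemma prime_perp_iff_minimal_prime:
  fixes I :: "'a::{distrib_lattice,order_bot} set"
  assumes I: "lattice_ideal I" "I \<noteq> {bot}"
  shows "prime_lattice_ideal (perp I) \<longleftrightarrow> minimal_prime_ideal (perp I)"
proof -
  obtain a where a: "a \<in> I" "bot < a" using nonzero_ideal_element[OF I] .
  have "perp I \<subseteq> Q" if Q: "prime_lattice_ideal Q" "Q \<subseteq> perp I" for Q
  proof
    fix x assume "x \<in> perp I"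
    then have "inf x a = bot" using a by (simp add: mem_perp_iff)
    moreover have "bot \<in> Q" using Q(1) lattice_ideal_bot unfolding prime_lattice_ideal_def by blast
    moreover have "a \<notin> Q" using Q a mem_own_perp by blast
    ultimately show "x \<in> Q" using Q unfolding prime_lattice_ideal_def by metis
  qed
  then show ?thesis
    unfolding minimal_prime_ideal_def minimal_in_def by blast
qed


section \<open>Maximal and minimal polars\<close>

text \<open>A proper polar \<^term>\<open>perp A\<close> above \<^term>\<open>perp I\<close> comes from an \<open>A\<close> with a nonzero
  element \<open>c\<close>. It cannot annihilate \<open>I\<close>, and any nonzero \<^term>\<open>inf c i\<close> gives
  \<^term>\<open>perp A \<subseteq> perp {inf c i}\<close>, where the larger ideal is \<^term>\<open>perp I\<close> again.\<close>

lemma perp_eq_iff_maximal_polar: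
  fixes I :: "'a::{distrib_lattice,order_bot} set"
  assumes I: "lattice_ideal I" "I \<noteq> {bot}"
  shows "(\<forall>a\<in>I. bot < a \<longrightarrow> perp {a} = perp I) \<longleftrightarrow> maximal_polar_ideal (perp I)"
proof
  assume const: "\<forall>a\<in>I. bot < a \<longrightarrow> perp {a} = perp I"
  have polar: "polar_ideal (perp I)" "perp I \<noteq> UNIV"
    using I lattice_ideal_bot[OF I(1)] by (auto simp: perp_eq_UNIV_iff intro!: polar_ideal_perp)
  have "Q = perp I" if Q: "polar_ideal Q" "Q \<noteq> UNIV" "perp I \<subseteq> Q" for Q
  proof -
    obtain A where A: "Q = perp A" using Q(1) unfolding polar_ideal_def by blast
    then obtain c where c: "c \<in> A" "c \<noteq> bot" using Q(2) by (auto simp: perp_eq_UNIV_iff)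
    then have "c \<notin> perp I" using A Q(3) mem_own_perp by blast
    then obtain i where i: "inf c i \<in> I" "bot < inf c i"
      using not_mem_perp_ideal[OF I(1)] by blast
    have "inf x (inf c i) = bot" if "x \<in> Q" for x
      using that c(1) unfolding A mem_perp_iff by (metis inf_assoc inf_bot_left')
    then have "Q \<subseteq> perp {inf c i}" by (auto simp: mem_perp_iff)
    then show ?thesis using const i Q(3) by blast
  qed
  with polar show "maximal_polar_ideal (perp I)"
    unfolding maximal_polar_ideal_def maximal_in_def by blast
next
  assume max: "maximal_polar_ideal (perp I)"
  show "\<forall>a\<in>I. bot < a \<longrightarrow> perp {a} = perp I"
  proof (intro ballI impI)
    fix a assume a: "a \<in> I" "bot < a"
    then have "perp {a} \<noteq> UNIV" by (auto simp: perp_eq_UNIV_iff)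
    moreover have "perp I \<subseteq> perp {a}" using a by (simp add: perp_antimono)
    moreover have "polar_ideal (perp {a})" by (simp add: polar_ideal_perp)
    ultimately show "perp {a} = perp I"
      using max unfolding maximal_polar_ideal_def maximal_in_def by blast
  qed
qed

text \<open>On polar ideals \<^const>\<open>perp\<close> is an order-reversing involution that exchanges the zero ideal
  and the whole lattice.\<close>

lemma maximal_polar_iff_minimal_polar_perp:
  fixes P :: "'a::{distrib_lattice,order_bot} set"
  assumes P: "polar_ideal P"
  shows "maximal_polar_ideal P \<longleftrightarrow> minimal_polar_ideal (perp P)"
proof -
  have swap: "perp Q \<noteq> {bot} \<longleftrightarrow> Q \<noteq> UNIV" "perp Q \<noteq> UNIV \<longleftrightarrow> Q \<noteq> {bot}"
    if "polar_ideal Q" for Q :: "'a set"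
  proof -
    have "perp {bot :: 'a} = UNIV" by (simp add: perp_eq_UNIV_iff)
    then show "perp Q \<noteq> {bot} \<longleftrightarrow> Q \<noteq> UNIV" "perp Q \<noteq> UNIV \<longleftrightarrow> Q \<noteq> {bot}"
      using polar_ideal_perp_perp[OF that] perp_UNIV[where 'a = 'a] by auto
  qed
  show ?thesis
  proof
    assume max: "maximal_polar_ideal P"
    have "N = perp P" if N: "polar_ideal N" "N \<noteq> {bot}" "N \<subseteq> perp P" for N
    proof -
      have "P \<subseteq> perp N" using perp_antimono[OF N(3)] polar_ideal_perp_perp[OF P] by simp
      moreover have "polar_ideal (perp N)" "perp N \<noteq> UNIV"
        using N swap polar_ideal_perp_polar by blast+
      ultimately have "perp N = P"
        using max unfolding maximal_polar_ideal_def maximal_in_def by blast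
      then show ?thesis using polar_ideal_perp_perp[OF N(1)] by blast
    qed
    moreover have "perp P \<noteq> {bot}"
      using max swap(1)[OF P] unfolding maximal_polar_ideal_def maximal_in_def by blast
    ultimately show "minimal_polar_ideal (perp P)"
      unfolding minimal_polar_ideal_def minimal_in_def using polar_ideal_perp_polar[OF P] by blast
  next
    assume min: "minimal_polar_ideal (perp P)"
    have "N = P" if N: "polar_ideal N" "N \<noteq> UNIV" "P \<subseteq> N" for N
    proof -
      have "perp N \<subseteq> perp P" using N(3) by (rule perp_antimono)
      moreover have "polar_ideal (perp N)" "perp N \<noteq> {bot}"
        using N swap polar_ideal_perp_polar by blast+
      ultimately have "perp N = perp P"
        using min unfolding minimal_polar_ideal_def minimal_in_def by blast
      then show ?thesis using polar_ideal_perp_perp N(1) P by metis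
    qed
    moreover have "P \<noteq> UNIV"
      using min swap(1)[OF P] unfolding minimal_polar_ideal_def minimal_in_def by blast
    ultimately show "maximal_polar_ideal P"
      unfolding maximal_polar_ideal_def maximal_in_def using P by blast
  qed
qed


section \<open>Maximal totally ordered ideals\<close>

text \<open>The ideals \<open>I\<close> and \<^term>\<open>perp (perp I)\<close> have the same annihilator, and being a chain depends
  only on whether this annihilator is prime. A chain ideal \<open>K\<close> above \<open>I\<close> satisfies
  \<^term>\<open>perp K = perp {a}\<close> and \<^term>\<open>perp {a} = perp I\<close> for any nonzero \<open>a\<close> in \<open>I\<close>, hence lies in
  \<^term>\<open>perp (perp I)\<close>.\<close>

lemma chain_ideal_iff_maximal_totally_ordered:
  fixes I :: "'a::decomposable_lattice set"
  assumes I: "lattice_ideal I" "I \<noteq> {bot}"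
  shows "Complete_Partial_Order.chain (\<le>) I \<longleftrightarrow> maximal_totally_ordered_ideal (perp (perp I))"
proof
  assume chain: "Complete_Partial_Order.chain (\<le>) I"
  let ?J = "perp (perp I)"
  obtain a where a: "a \<in> I" "bot < a" using nonzero_ideal_element[OF I] .
  have J: "lattice_ideal ?J" "?J \<noteq> {bot}"
    using a subset_perp_perp[of I] by (auto simp: lattice_ideal_perp)
  have "prime_lattice_ideal (perp ?J)"
    using chain chain_ideal_iff_perp_eq[OF I(1)] perp_eq_iff_prime[OF I] by (simp add: perp_perp_perp)
  then have "Complete_Partial_Order.chain (\<le>) ?J"
    using chain_ideal_iff_perp_eq[OF J(1)] perp_eq_iff_prime[OF J] by simp
  moreover have "K = ?J"
    if K: "lattice_ideal K" "Complete_Partial_Order.chain (\<le>) K" "?J \<subseteq> K" for K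
  proof -
    have "a \<in> K" using a(1) K(3) subset_perp_perp by blast
    then have "perp K = perp I"
      using chain_ideal_imp_perp_eq K(1,2) I(1) chain a by metis
    then have "K \<subseteq> ?J" using subset_perp_perp by metis
    then show ?thesis using K(3) by blast
  qed
  ultimately show "maximal_totally_ordered_ideal ?J"
    unfolding maximal_totally_ordered_ideal_def maximal_in_def using J(1) by blast
next
  assume "maximal_totally_ordered_ideal (perp (perp I))"
  then have "Complete_Partial_Order.chain (\<le>) (perp (perp I))"
    unfolding maximal_totally_ordered_ideal_def maximal_in_def by blast
  then show "Complete_Partial_Order.chain (\<le>) I"
    using subset_perp_perp by (rule chain_subset)
qed


section \<open>Values and special elements\<close>

text \<open>By Zorn's lemma, since the union of a chain of ideals is an ideal.\<close>

lemma ideal_extends_to_value: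
  fixes J :: "'a::lattice set"
  assumes J: "lattice_ideal J" "a \<notin> J"
  obtains V where "value_of a V" and "J \<subseteq> V"
proof -
  let ?F = "{K. lattice_ideal K \<and> a \<notin> K \<and> J \<subseteq> K}"
  have "\<exists>M\<in>?F. \<forall>X\<in>?F. M \<subseteq> X \<longrightarrow> X = M"
  proof (rule subset_Zorn_nonempty)
    show "?F \<noteq> {}" using J by blast
    fix C assume C: "C \<noteq> {}" "subset.chain ?F C"
    then have CF: "\<And>K. K \<in> C \<Longrightarrow> lattice_ideal K \<and> a \<notin> K \<and> J \<subseteq> K"
      by (auto simp: subset_chain_def)
    have "sup x y \<in> \<Union>C" if xy: "x \<in> \<Union>C" "y \<in> \<Union>C" for x y
    proof -
      obtain K M where KM: "K \<in> C" "x \<in> K" "M \<in> C" "y \<in> M" using xy by blast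
      then have "K \<subseteq> M \<or> M \<subseteq> K" using C(2) by (auto simp: subset_chain_def)
      then show ?thesis using KM CF lattice_ideal_sup by blast
    qed
    moreover have "y \<in> \<Union>C" if "x \<in> \<Union>C" "y \<le> x" for x y
      using that CF lattice_ideal_downward by blast
    moreover have "\<Union>C \<noteq> {}" using C(1) CF lattice_ideal_nonempty by fast
    ultimately have "lattice_ideal (\<Union>C)" unfolding lattice_ideal_def by blast
    then show "\<Union>C \<in> ?F" using C(1) CF by blast
  qed
  then obtain V where V: "V \<in> ?F" "\<forall>X\<in>?F. V \<subseteq> X \<longrightarrow> X = V" by blast
  then have "value_of a V" unfolding value_of_def maximal_in_def by blast
  then show thesis using that V(1) by blast
qed

text \<open>By maximality, the ideal generated by a value of \<open>a\<close> and an outside element contains \<open>a\<close>.\<close>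

lemma value_of_cover:
  fixes V :: "'a::distrib_lattice set"
  assumes V: "value_of a V" and x: "x \<notin> V"
  obtains w where "w \<in> V" and "a \<le> sup w x"
proof -
  have V': "lattice_ideal V" using V unfolding value_of_def maximal_in_def by blast
  let ?G = "{z. \<exists>w\<in>V. z \<le> sup w x}"
  obtain v where v: "v \<in> V" using lattice_ideal_nonempty[OF V'] by blast
  have "sup y z \<in> ?G" if yz: "y \<in> ?G" "z \<in> ?G" for y z
  proof -
    obtain p q where pq: "p \<in> V" "q \<in> V" "y \<le> sup p x" "z \<le> sup q x" using yz by blast
    have "y \<le> sup (sup p q) x" using pq(3) by (rule order_trans) (simp add: le_supI1)
    moreover have "z \<le> sup (sup p q) x" using pq(4) by (rule order_trans) (simp add: le_supI1)
    ultimately have "sup y z \<le> sup (sup p q) x" by simp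
    then show ?thesis using lattice_ideal_sup[OF V' pq(1,2)] by blast
  qed
  moreover have "z \<in> ?G" if "y \<in> ?G" "z \<le> y" for y z
    using that order_trans by blast
  moreover have "V \<subseteq> ?G" "x \<in> ?G" using v by (auto intro: sup_ge1 sup_ge2)
  ultimately have "lattice_ideal ?G" unfolding lattice_ideal_def using v by blast
  moreover have "?G \<noteq> V" using \<open>x \<in> ?G\<close> x by blast
  ultimately have "a \<in> ?G"
    using V \<open>V \<subseteq> ?G\<close> unfolding value_of_def maximal_in_def by blast
  then show thesis using that by blast
qed

text \<open>For values \<open>V\<close> and \<open>W\<close> of \<open>a\<close> and \<open>x\<close> in \<open>V\<close> but not in \<open>W\<close>, the previous lemma
  gives \<open>w\<close> in \<open>W\<close> such that \<open>a\<close> is the join of \<^term>\<open>inf a w\<close> and \<^term>\<open>inf a x\<close>. Inside a chain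
  this join is one of the two, so \<open>a\<close> would belong to \<open>W\<close> or to \<open>V\<close>.\<close>

lemma chain_ideal_imp_special:
  fixes I :: "'a::{distrib_lattice,order_bot} set"
  assumes I: "lattice_ideal I" and chain: "Complete_Partial_Order.chain (\<le>) I"
    and a: "a \<in> I" "bot < a"
  shows "special a"
proof -
  have sub: "V \<subseteq> W" if V: "value_of a V" and W: "value_of a W" for V W
  proof
    fix x assume x: "x \<in> V"
    show "x \<in> W"
    proof (rule ccontr)
      assume "x \<notin> W"
      then obtain w where w: "w \<in> W" "a \<le> sup w x" using value_of_cover[OF W] by blast
      then have split: "a = sup (inf a w) (inf a x)"
        by (metis inf_absorb1 inf_sup_distrib1)
      have "inf a w \<in> I" "inf a x \<in> I"
        using lattice_ideal_downward[OF I a(1) inf_le1] by blast+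
      then have "inf a w \<le> inf a x \<or> inf a x \<le> inf a w" by (rule chainD[OF chain])
      then have "a = inf a x \<or> a = inf a w" using split by (metis sup_absorb1 sup_absorb2)
      then have "a \<le> x \<or> a \<le> w" by (metis inf_le2)
      moreover have "lattice_ideal V" "a \<notin> V" "lattice_ideal W" "a \<notin> W"
        using V W unfolding value_of_def maximal_in_def by blast+
      ultimately show False using x w(1) lattice_ideal_downward by blast
    qed
  qed
  have "a \<notin> {..bot}" using a(2) by (simp add: less_le_not_le)
  from ideal_extends_to_value[OF lattice_ideal_atMost this]
  obtain V where V: "value_of a V" .
  then have "W = V" if "value_of a W" for W using that by (intro subset_antisym sub)
  with V show ?thesis unfolding special_def by (rule ex1I)
qed

text \<open>Two disjoint nonzero elements \<open>x\<close> and \<open>y\<close> of \<open>I\<close> would give \<^term>\<open>sup x y\<close> a value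
  that contains \<open>x\<close> and a value that contains \<open>y\<close>. If they were equal, this value would contain
  \<^term>\<open>sup x y\<close>.\<close>

lemma special_imp_chain_ideal:
  fixes I :: "'a::decomposable_lattice set"
  assumes I: "lattice_ideal I" and special: "\<forall>a\<in>I. bot < a \<longrightarrow> special a"
  shows "Complete_Partial_Order.chain (\<le>) I"
proof (rule chainI, rule ccontr)
  fix a b assume ab: "a \<in> I" "b \<in> I" "\<not> (a \<le> b \<or> b \<le> a)"
  then obtain x y where xy: "x \<le> a" "y \<le> b" "bot < x" "bot < y" "inf x y = bot"
    using incomparable_imp_disjoint_parts by blast
  let ?c = "sup x y"
  have "x \<in> I" "y \<in> I" using ab xy lattice_ideal_downward[OF I] by blast+
  then have "?c \<in> I" using lattice_ideal_sup[OF I] by blast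
  moreover have "bot < ?c" using xy(3) by (rule less_supI1)
  ultimately have unique: "V = W" if "value_of ?c V" "value_of ?c W" for V W
    using special that unfolding special_def by metis
  have "\<not> y \<le> x" "\<not> x \<le> y" using xy(3-5) by (metis inf_absorb1 inf_absorb2 less_irrefl)+
  then have "?c \<notin> {..x}" "?c \<notin> {..y}" by simp_all
  then obtain V W where V: "value_of ?c V" "{..x} \<subseteq> V" and W: "value_of ?c W" "{..y} \<subseteq> W"
    using ideal_extends_to_value[OF lattice_ideal_atMost] by metis
  have "x \<in> V" "y \<in> V" using V(2) W(2) unique[OF V(1) W(1)] by auto
  moreover have "lattice_ideal V" "?c \<notin> V"
    using V(1) unfolding value_of_def maximal_in_def by blast+
  ultimately show False using lattice_ideal_sup by blast
qed


section \<open>The equivalences\<close>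

theorem theorem4p6:
  fixes I :: "'a::decomposable_lattice set"
  assumes "lattice_ideal I" and "I \<noteq> {bot}"
  shows "(Complete_Partial_Order.chain (\<le>) I \<longleftrightarrow> (\<forall>a\<in>I. bot < a \<longrightarrow> perp {a} = perp I))
       \<and> (Complete_Partial_Order.chain (\<le>) I \<longleftrightarrow> prime_lattice_ideal (perp I))
       \<and> (Complete_Partial_Order.chain (\<le>) I \<longleftrightarrow> minimal_prime_ideal (perp I))
       \<and> (Complete_Partial_Order.chain (\<le>) I \<longleftrightarrow> maximal_totally_ordered_ideal (perp (perp I)))
       \<and> (Complete_Partial_Order.chain (\<le>) I \<longleftrightarrow> minimal_polar_ideal (perp (perp I)))
       \<and> (Complete_Partial_Order.chain (\<le>) I \<longleftrightarrow> maximal_polar_ideal (perp I))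
       \<and> (Complete_Partial_Order.chain (\<le>) I \<longleftrightarrow> (\<forall>a\<in>I. bot < a \<longrightarrow> special a))"
proof -
  have "I \<noteq> {}" using assms(1) by (rule lattice_ideal_nonempty)
  then have polar: "polar_ideal (perp I)" by (rule polar_ideal_perp)
  have special: "Complete_Partial_Order.chain (\<le>) I \<longleftrightarrow> (\<forall>a\<in>I. bot < a \<longrightarrow> special a)"
    using chain_ideal_imp_special[OF assms(1)] special_imp_chain_ideal[OF assms(1)] by blast
  note const = chain_ideal_iff_perp_eq[OF assms(1)]
  note prime = trans[OF const perp_eq_iff_prime[OF assms]]
  note maximal = trans[OF const perp_eq_iff_maximal_polar[OF assms]]
  show ?thesis
    by (intro conjI const prime maximal special
        trans[OF prime prime_perp_iff_minimal_prime[OF assms]]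
        trans[OF maximal maximal_polar_iff_minimal_polar_perp[OF polar]]
        chain_ideal_iff_maximal_totally_ordered[OF assms])
qed

end
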